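(* Let $f:[0,1]\to[0,1]$ be a continuous map which is topologically mixing and countably Markov with a partition set $P$, and suppose that $f$ is leo (locally eventually onto). Then $$\Lambda(f)=\exp h(f),$$ where $h(f)$ denotes the topological entropy of $f$.
   Context: For a continuous map $f:[0,1]\to[0,1]$, $\Lambda(f)$ is the infimum of all real $\lambda$ such that for some homeomorphism $\psi:[0,1]\to[0,1]$ the map $g=\psi\circ f\circ\psi^{-1}$ has Lipschitz constant $\lambda$, i.e. $|g(x)-g(y)|\le\lambda|x-y|$ for all $x,y\in[0,1]$ (the infimum of the empty set is $\infty$, and $\exp\infty=\infty$). $f$ is topologically mixing if for each pair of nonempty open sets $U,V\subset[0,1]$ there is $n_0\ge 0$ such that $f^n(U)\cap V\ne\emptyset$ for every $n\ge n_0$. $f$ is countably Markov if there is a closed, countable (possibly finite) set $P\subset[0,1]$ with $0,1\in P$, $f(P)\subset P$, and $f|_I$ monotone on each connected component $I$ of $[0,1]\setminus P$. Such a $P$ is called a partition set for $f$. $f$ is leo (locally eventually onto) if for every nonempty open set $U\subset[0,1]$ there is $n\in\mathbb N$ such that $f^n(U)=[0,1]$. *)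

theory Defs
  imports "HOL-Analysis.Analysis"
begin

text \<open>A self-map of \<open>[0,1]\<close> is a function on \<open>real\<close> mapping \<open>{0..1}\<close> into itself; only its values
  on \<open>{0..1}\<close> matter. Iterates are \<open>f ^^ n\<close>.\<close>

definition interval_map :: "(real \<Rightarrow> real) \<Rightarrow> bool" where
  "interval_map f \<longleftrightarrow> continuous_on {0..1} f \<and> f ` {0..1} \<subseteq> {0..1}"

definition ereal_exp :: "ereal \<Rightarrow> ereal" where
  "ereal_exp x = (case x of ereal r \<Rightarrow> ereal (exp r) | PInfty \<Rightarrow> \<infinity> | MInfty \<Rightarrow> 0)"

text \<open>The infimum is taken in \<open>ereal\<close>, so it is \<open>\<infinity>\<close> if no conjugate of \<open>f\<close> is Lipschitz.
  The condition \<open>0 \<le> L\<close> in \<open>lipschitz_on\<close> is automatic on \<open>{0..1}\<close>.\<close>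

definition inf_lipschitz :: "(real \<Rightarrow> real) \<Rightarrow> ereal" where
  "inf_lipschitz f = Inf {ereal L | L.
     \<exists>(\<psi> :: real \<Rightarrow> real) (\<psi>' :: real \<Rightarrow> real).
       homeomorphism {0..1} {0..1} \<psi> \<psi>' \<and>
       lipschitz_on L {0..1} (\<psi> \<circ> f \<circ> \<psi>')}"

definition topologically_mixing :: "(real \<Rightarrow> real) \<Rightarrow> bool" where
  "topologically_mixing f \<longleftrightarrow>
     (\<forall>U V. openin (top_of_set {0..1}) U \<and> U \<noteq> {} \<and> openin (top_of_set {0..1}) V \<and> V \<noteq> {}
        \<longrightarrow> (\<exists>n0. \<forall>n\<ge>n0. (f ^^ n) ` U \<inter> V \<noteq> {}))"

definition leo :: "(real \<Rightarrow> real) \<Rightarrow> bool" where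
  "leo f \<longleftrightarrow>
     (\<forall>U. openin (top_of_set {0..1}) U \<and> U \<noteq> {} \<longrightarrow> (\<exists>n. (f ^^ n) ` U = {0..1}))"

definition partition_set :: "(real \<Rightarrow> real) \<Rightarrow> real set \<Rightarrow> bool" where
  "partition_set f P \<longleftrightarrow>
     P \<subseteq> {0..1} \<and> closed P \<and> countable P \<and> 0 \<in> P \<and> 1 \<in> P \<and> f ` P \<subseteq> P
     \<and> (\<forall>I \<in> components ({0..1} - P). mono_on I f \<or> antimono_on I f)"

definition countably_markov :: "(real \<Rightarrow> real) \<Rightarrow> bool" where
  "countably_markov f \<longleftrightarrow> (\<exists>P. partition_set f P)"

text \<open>Topological entropy of \<open>f\<close> on a compact \<open>f\<close>-invariant set \<open>X\<close> in Bowen's form,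
  \<open>lim\<^sub>\<epsilon>\<^sub>\<rightarrow>\<^sub>0 limsup\<^sub>n (1/n) log s(n,\<epsilon>)\<close>, where \<open>s(n,\<epsilon>)\<close> is the maximal cardinality of an
  \<open>(n,\<epsilon>)\<close>-separated subset of \<open>X\<close>. The inner supremum is \<open>(1/n) log s(n,\<epsilon>)\<close>, taken in \<open>ereal\<close>
  so that unboundedness is not lost. As the limsup is antitone in \<open>\<epsilon>\<close>, the limit for
  \<open>\<epsilon> \<rightarrow> 0\<close> is a supremum. The empty set contributes \<open>ln 0 = 0\<close>, the same as a singleton.\<close>

definition separated_set :: "('a::metric_space \<Rightarrow> 'a) \<Rightarrow> nat \<Rightarrow> real \<Rightarrow> 'a set \<Rightarrow> bool" where
  "separated_set f n \<epsilon> E \<longleftrightarrow>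
     (\<forall>x\<in>E. \<forall>y\<in>E. x \<noteq> y \<longrightarrow> (\<exists>i<n. dist ((f ^^ i) x) ((f ^^ i) y) > \<epsilon>))"

definition topological_entropy :: "'a::metric_space set \<Rightarrow> ('a \<Rightarrow> 'a) \<Rightarrow> ereal" where
  "topological_entropy X f =
     (SUP \<epsilon>\<in>{0<..}. limsup (\<lambda>n.
        SUP E\<in>{E. E \<subseteq> X \<and> finite E \<and> separated_set f n \<epsilon> E}. ereal (ln (real (card E)) / real n)))"

end

theory Submission
  imports Defs
begin

text \<open>If some conjugate of \<open>f\<close> is \<open>L\<close>-Lipschitz, then \<open>(n, \<epsilon>)\<close>-separated sets have \<open>O(L\<^sup>n)\<close> points, so
  \<open>h(f) \<le> ln L\<close>. Conversely, fix a component \<open>J\<close> of the complement of \<open>P\<close>. The Markov property makes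
  \<open>f\<^sup>n\<close> map each component of the preimage of \<open>J\<close> under \<open>f\<^sup>n\<close> monotonically across \<open>J\<close>. As \<open>f\<close> is leo, some
  \<open>f\<^sup>m\<close> maps \<open>J\<close> onto everything, so \<open>k\<close> such components yield a \<open>k\<close>-fold horseshoe for
  \<open>f\<^sup>n\<^sup>+\<^sup>m\<close>, whence \<open>k \<le> exp ((n + m) h(f))\<close>. For \<open>L > exp h(f)\<close> the series
  \<open>\<Psi>(x) = \<Sum>n. V\<^sub>n(x) / L\<^sup>n\<close> therefore converges, where \<open>V\<^sub>n(x)\<close> is the variation of \<open>f\<^sup>n\<close> over the
  part of \<open>[0,x]\<close> that \<open>f\<^sup>n\<close> maps into \<open>J\<close>. The variation of \<open>f\<^sup>n\<close> over \<open>f(I)\<close> is at most that of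
  \<open>f\<^sup>n\<^sup>+\<^sup>1\<close> over \<open>I\<close>, so \<open>\<Psi>\<close>, normalised, conjugates \<open>f\<close> to an \<open>L\<close>-Lipschitz map.\<close>

section \<open>Entropy bounds\<close>

text \<open>Every word over \<open>I\<close> is the itinerary of some point observed at multiples of
  \<open>N\<close>. Disjoint compact sets are a positive distance apart, so different words yield
  separated points.\<close>

lemma horseshoe_entropy:
  fixes f :: "'a::heine_borel \<Rightarrow> 'a" and A :: "'i \<Rightarrow> 'a set"
  assumes fin: "finite I" and ne: "I \<noteq> {}" and N: "N > 0"
    and AX: "\<And>i. i \<in> I \<Longrightarrow> A i \<subseteq> X"
    and cpt: "\<And>i. i \<in> I \<Longrightarrow> compact (A i)"
    and nemp: "\<And>i. i \<in> I \<Longrightarrow> A i \<noteq> {}"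
    and disj: "\<And>i j. i \<in> I \<Longrightarrow> j \<in> I \<Longrightarrow> i \<noteq> j \<Longrightarrow> A i \<inter> A j = {}"
    and cover: "\<And>i j. i \<in> I \<Longrightarrow> j \<in> I \<Longrightarrow> A j \<subseteq> (f ^^ N) ` A i"
  shows "ereal (ln (real (card I)) / real N) \<le> topological_entropy X f"
proof -
  have "\<exists>d>0. \<forall>x\<in>A i. \<forall>y\<in>A j. d \<le> dist x y" if "i \<in> I" "j \<in> I" "i \<noteq> j" for i j
    using separate_compact_closed[of "A i" "A j"] cpt compact_imp_closed disj that by metis
  then obtain d where d: "\<And>i j. i \<in> I \<Longrightarrow> j \<in> I \<Longrightarrow> i \<noteq> j \<Longrightarrow>
      d i j > 0 \<and> (\<forall>x\<in>A i. \<forall>y\<in>A j. d i j \<le> dist x y)"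
    by metis
  \<comment> \<open>The inserted \<open>1\<close> keeps \<open>D\<close> nonempty when
    \<open>I\<close> is a singleton; halving its minimum below makes the separation strict.\<close>
  define D where "D = insert 1 ((\<lambda>(i, j). d i j) ` {(i, j) \<in> I \<times> I. i \<noteq> j})"
  have finD: "finite D"
    unfolding D_def using fin by (auto intro!: finite_imageI finite_subset[OF _ finite_cartesian_product[OF fin fin]])
  define \<epsilon> where "\<epsilon> = Min D / 2"
  have Dpos: "Min D > 0"
    using finD d by (subst Min_gr_iff) (auto simp: D_def)
  have eps: "\<epsilon> > 0" using Dpos by (simp add: \<epsilon>_def)
  have sep: "\<epsilon> < dist x y" if "i \<in> I" "j \<in> I" "i \<noteq> j" "x \<in> A i" "y \<in> A j" for i j x y
  proof -
    have "Min D \<le> d i j" using finD that by (intro Min_le) (auto simp: D_def)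
    also have "\<dots> \<le> dist x y" using d[OF that(1-3)] that by blast
    finally show ?thesis using Dpos by (simp add: \<epsilon>_def)
  qed
  \<comment> \<open>Itineraries are built from the back: a point realising the tail is pulled back
    into the first set by \<open>cover\<close>.\<close>
  have word: "\<exists>x\<in>A (hd w). \<forall>i<length w. (f ^^ (N * i)) x \<in> A (w ! i)"
    if "w \<noteq> []" "set w \<subseteq> I" for w
    using that
  proof (induction w)
    case (Cons i w)
    show ?case
    proof (cases "w = []")
      case True
      then show ?thesis using nemp[of i] Cons.prems by auto
    next
      case False
      then obtain y where y: "y \<in> A (hd w)" "\<forall>j<length w. (f ^^ (N * j)) y \<in> A (w ! j)"
        using Cons by auto
      have "hd w \<in> I" using False Cons.prems by (cases w) auto
      then obtain x where x: "x \<in> A i" "y = (f ^^ N) x" using cover[of i "hd w"] y(1) Cons.prems by auto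
      have "(f ^^ (N * j)) x \<in> A ((i # w) ! j)" if "j < length (i # w)" for j
      proof (cases j)
        case 0
        then show ?thesis using x by simp
      next
        case (Suc k)
        have "(f ^^ (N * j)) x = (f ^^ (N * k)) ((f ^^ N) x)"
          by (simp add: Suc add.commute[of N] funpow_add)
        then show ?thesis using y(2) x that Suc by simp
      qed
      then show ?thesis using x by auto
    qed
  qed simp
  define S where "S = (\<lambda>n. SUP E\<in>{E. E \<subseteq> X \<and> finite E \<and> separated_set f n \<epsilon> E}. ereal (ln (real (card E)) / real n))"
  \<comment> \<open>Words of length \<open>Suc l\<close> are told apart by time
    \<open>N * l\<close>. The logarithm of their number and the time \<open>N * Suc l\<close> both
    scale with \<open>Suc l\<close>, so the quotient does not depend on \<open>l\<close>.\<close>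
  have low: "ereal (ln (real (card I)) / real N) \<le> S (N * Suc l)" for l
  proof -
    define W where "W = {w. set w \<subseteq> I \<and> length w = Suc l}"
    have "\<forall>w\<in>W. \<exists>x. x \<in> X \<and> (\<forall>i<Suc l. (f ^^ (N * i)) x \<in> A (w ! i))"
    proof
      fix w assume w: "w \<in> W"
      then have "w \<noteq> []" "set w \<subseteq> I" "length w = Suc l" by (auto simp: W_def)
      with word[of w] obtain x where "x \<in> A (hd w)" "\<forall>i<Suc l. (f ^^ (N * i)) x \<in> A (w ! i)" by auto
      moreover have "hd w \<in> I" using \<open>w \<noteq> []\<close> \<open>set w \<subseteq> I\<close> by (cases w) auto
      ultimately show "\<exists>x. x \<in> X \<and> (\<forall>i<Suc l. (f ^^ (N * i)) x \<in> A (w ! i))" using AX by blast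
    qed
    from bchoice[OF this] obtain x where x: "\<And>w. w \<in> W \<Longrightarrow> x w \<in> X"
        "\<And>w i. w \<in> W \<Longrightarrow> i < Suc l \<Longrightarrow> (f ^^ (N * i)) (x w) \<in> A (w ! i)" by auto
    have sepw: "\<exists>i<N * Suc l. dist ((f ^^ i) (x v)) ((f ^^ i) (x w)) > \<epsilon>"
      if vw: "v \<in> W" "w \<in> W" "v \<noteq> w" for v w
    proof -
      obtain i where i: "i < Suc l" "v ! i \<noteq> w ! i"
        using vw nth_equalityI[of v w] by (auto simp: W_def)
      have "v ! i \<in> I" "w ! i \<in> I" using vw i by (auto simp: W_def)
      then have "dist ((f ^^ (N * i)) (x v)) ((f ^^ (N * i)) (x w)) > \<epsilon>"
        using sep i x vw by blast
      moreover have "N * i < N * Suc l" using i N by (simp del: mult_Suc_right)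
      ultimately show ?thesis by blast
    qed
    have inj: "inj_on x W"
    proof (rule inj_onI, rule ccontr)
      fix v w assume "v \<in> W" "w \<in> W" "x v = x w" "v \<noteq> w"
      with sepw[of v w] eps show False by auto
    qed
    have cardW: "card W = card I ^ Suc l" unfolding W_def by (rule card_lists_length_eq[OF fin])
    have finW: "finite W" unfolding W_def by (rule finite_lists_length_eq[OF fin])
    have "separated_set f (N * Suc l) \<epsilon> (x ` W)"
      using sepw unfolding separated_set_def by blast
    then have "x ` W \<in> {E. E \<subseteq> X \<and> finite E \<and> separated_set f (N * Suc l) \<epsilon> E}"
      using x(1) finW by blast
    then have "ereal (ln (real (card (x ` W))) / real (N * Suc l)) \<le> S (N * Suc l)"
      unfolding S_def by (rule SUP_upper)
    moreover have "card I > 0" using fin ne by (simp add: card_gt_0_iff)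
    then have "ln (real (card (x ` W))) / real (N * Suc l) = ln (real (card I)) / real N"
      using N by (simp only: card_image[OF inj] cardW of_nat_power of_nat_mult ln_realpow) (simp del: of_nat_Suc)
    ultimately show ?thesis by simp
  qed
  have "ereal (ln (real (card I)) / real N) \<le> limsup (S \<circ> (\<lambda>l. N * Suc l))"
    using low by (intro le_Limsup) (auto simp del: mult_Suc_right)
  also have "\<dots> \<le> limsup S"
    using N by (intro limsup_subseq_mono) (simp add: strict_mono_def)
  also have "\<dots> \<le> topological_entropy X f"
    unfolding topological_entropy_def S_def using eps by (intro SUP_upper) auto
  finally show ?thesis .
qed

lemma topological_entropy_nonneg: "0 \<le> topological_entropy X f"
proof -
  \<comment> \<open>The witness is the empty set: it is vacuously separated and has value
    \<open>ln 0 / n = 0\<close>.\<close>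
  have "0 \<le> limsup (\<lambda>n. SUP E\<in>{E. E \<subseteq> X \<and> finite E \<and> separated_set f n 1 E}. ereal (ln (real (card E)) / real n))"
    by (intro le_Limsup always_eventually allI SUP_upper2[of "{}"]) (auto simp: separated_set_def)
  also have "\<dots> \<le> topological_entropy X f"
    unfolding topological_entropy_def by (intro SUP_upper) auto
  finally show ?thesis .
qed

section \<open>Lipschitz conjugates bound the entropy from above\<close>

lemma card_spaced_le:
  fixes E :: "real set"
  assumes E: "finite E" "E \<subseteq> {0..1}" and d: "d > 0"
    and sp: "\<And>x y. x \<in> E \<Longrightarrow> y \<in> E \<Longrightarrow> x \<noteq> y \<Longrightarrow> d \<le> \<bar>x - y\<bar>"
  shows "real (card E) \<le> 1 / d + 1"
proof -
  \<comment> \<open>Pigeonhole: a half-open cell of length \<open>d\<close> holds at most one point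
    of \<open>E\<close>.\<close>
  have "inj_on (\<lambda>x. \<lfloor>x / d\<rfloor>) E"
  proof (rule inj_onI, rule ccontr)
    fix x y assume xy: "x \<in> E" "y \<in> E" "\<lfloor>x / d\<rfloor> = \<lfloor>y / d\<rfloor>" "x \<noteq> y"
    then have "\<bar>x / d - y / d\<bar> < 1" by linarith
    then have "\<bar>x - y\<bar> < d" using d by (simp add: field_simps flip: diff_divide_distrib)
    with sp[OF xy(1,2,4)] show False by simp
  qed
  moreover have "(\<lambda>x. \<lfloor>x / d\<rfloor>) ` E \<subseteq> {0..\<lfloor>1 / d\<rfloor>}"
    using E d by (fastforce intro!: floor_mono divide_right_mono)
  ultimately have "card E \<le> card {0..\<lfloor>1 / d\<rfloor>}" by (intro card_inj_on_le) auto
  moreover have "0 \<le> \<lfloor>1 / d\<rfloor>" using d by simp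
  ultimately have "int (card E) \<le> \<lfloor>1 / d\<rfloor> + 1"
    unfolding card_atLeastAtMost_int by linarith
  then show ?thesis by linarith
qed

lemma funpow_in_interval:
  assumes "interval_map f" "x \<in> {0..1}"
  shows "(f ^^ n) x \<in> {0..1}"
  using assms by (induction n) (auto simp: interval_map_def image_subset_iff)

lemma continuous_on_funpow_interval:
  assumes "interval_map f"
  shows "continuous_on {0..1} (f ^^ n)"
proof (induction n)
  case (Suc n)
  have "continuous_on {0..1} (f \<circ> (f ^^ n))"
    using Suc assms funpow_in_interval[OF assms]
    by (intro continuous_on_compose) (auto simp: interval_map_def image_subset_iff intro: continuous_on_subset)
  then show ?case by simp
qed (simp add: id_def continuous_on_id)

text \<open>In the coordinate \<open>\<psi>\<close> each iterate stretches distances by at most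
  \<open>L\<close>, so points that separate within \<open>n\<close> steps start at least a constant
  multiple of \<open>1 / L ^ n\<close> apart, and few of them fit into the unit interval.\<close>

lemma entropy_le_ln_lipschitz:
  fixes f \<psi> \<psi>' :: "real \<Rightarrow> real"
  assumes im: "interval_map f"
    and hom: "homeomorphism {0..1} {0..1} \<psi> \<psi>'"
    and lip: "lipschitz_on L {0..1} (\<psi> \<circ> f \<circ> \<psi>')"
    and L: "1 \<le> L"
  shows "topological_entropy {0..1} f \<le> ereal (ln L)"
  unfolding topological_entropy_def
proof (rule SUP_least)
  fix \<epsilon> :: real assume "\<epsilon> \<in> {0<..}"
  then have eps: "\<epsilon> > 0" by simp
  have psi_in: "\<psi> x \<in> {0..1}" "\<psi>' x \<in> {0..1}" "\<psi>' (\<psi> x) = x" if "x \<in> {0..1}" for x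
    using hom that unfolding homeomorphism_def by auto
  \<comment> \<open>\<open>\<delta>\<close> converts the scale: points more than
    \<open>\<epsilon>\<close> apart have \<open>\<psi>\<close>-images at least
    \<open>\<delta>\<close> apart.\<close>
  have "uniformly_continuous_on {0..1} \<psi>'"
    using hom by (intro compact_uniformly_continuous) (auto simp: homeomorphism_def)
  then obtain \<delta> where \<delta>: "\<delta> > 0"
      "\<And>u v. u \<in> {0..1} \<Longrightarrow> v \<in> {0..1} \<Longrightarrow> dist u v < \<delta> \<Longrightarrow> dist (\<psi>' u) (\<psi>' v) < \<epsilon>"
    using eps unfolding uniformly_continuous_on_def by metis
  have orbit: "\<bar>\<psi> ((f ^^ i) x) - \<psi> ((f ^^ i) y)\<bar> \<le> L ^ i * \<bar>\<psi> x - \<psi> y\<bar>"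
    if "x \<in> {0..1}" "y \<in> {0..1}" for i x y
  proof (induction i)
    case (Suc i)
    let ?u = "(f ^^ i) x" and ?v = "(f ^^ i) y"
    have uv: "?u \<in> {0..1}" "?v \<in> {0..1}" using that funpow_in_interval[OF im] by auto
    have "\<bar>\<psi> (f ?u) - \<psi> (f ?v)\<bar> \<le> L * \<bar>\<psi> ?u - \<psi> ?v\<bar>"
      using lipschitz_onD[OF lip, of "\<psi> ?u" "\<psi> ?v"] psi_in[OF uv(1)] psi_in[OF uv(2)]
      by (simp add: dist_real_def)
    also have "\<dots> \<le> L * (L ^ i * \<bar>\<psi> x - \<psi> y\<bar>)" using Suc L by (intro mult_left_mono) auto
    finally show ?case by simp
  qed simp
  have bound: "ln (real (card E)) / real n \<le> ln L + ln (1 / \<delta> + 1) / real n"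
    if E: "E \<subseteq> {0..1}" "finite E" "separated_set f n \<epsilon> E" and n: "n > 0" for E n
  proof (cases "E = {}")
    case True
    then show ?thesis using L \<delta>(1) by (auto intro!: add_nonneg_nonneg divide_nonneg_nonneg)
  next
    case False
    have sp: "\<delta> / L ^ n \<le> \<bar>\<psi> x - \<psi> y\<bar>" if xy: "x \<in> E" "y \<in> E" "x \<noteq> y" for x y
    proof -
      have xy': "x \<in> {0..1}" "y \<in> {0..1}" using xy E by auto
      obtain i where i: "i < n" "dist ((f ^^ i) x) ((f ^^ i) y) > \<epsilon>"
        using E(3) xy unfolding separated_set_def by blast
      let ?u = "(f ^^ i) x" and ?v = "(f ^^ i) y"
      have uv: "?u \<in> {0..1}" "?v \<in> {0..1}" using xy' funpow_in_interval[OF im] by auto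
      have "\<delta> \<le> \<bar>\<psi> ?u - \<psi> ?v\<bar>"
        using \<delta>(2)[of "\<psi> ?u" "\<psi> ?v"] i psi_in[OF uv(1)] psi_in[OF uv(2)]
        by (force simp: dist_real_def)
      also have "\<dots> \<le> L ^ i * \<bar>\<psi> x - \<psi> y\<bar>" by (rule orbit[OF xy'])
      also have "\<dots> \<le> L ^ n * \<bar>\<psi> x - \<psi> y\<bar>"
        using L i by (intro mult_right_mono power_increasing) auto
      finally show ?thesis using L by (simp add: field_simps)
    qed
    have inj: "inj_on \<psi> E"
      using E psi_in by (metis inj_on_def subsetD)
    have "real (card (\<psi> ` E)) \<le> 1 / (\<delta> / L ^ n) + 1"
    proof (rule card_spaced_le)
      show "\<psi> ` E \<subseteq> {0..1}" using E(1) psi_in(1) by blast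
      show "\<delta> / L ^ n \<le> \<bar>u - v\<bar>" if "u \<in> \<psi> ` E" "v \<in> \<psi> ` E" "u \<noteq> v" for u v
        using that sp by blast
    qed (use E(2) \<delta>(1) L in auto)
    then have "real (card E) \<le> L ^ n / \<delta> + 1" by (simp add: card_image[OF inj])
    \<comment> \<open>\<open>1 \<le> L\<close> absorbs the additive \<open>1\<close> into the factor
      \<open>L ^ n\<close>.\<close>
    also have "\<dots> \<le> L ^ n * (1 / \<delta> + 1)" using L by (simp add: algebra_simps)
    finally have "ln (real (card E)) \<le> ln (L ^ n * (1 / \<delta> + 1))"
      using False E(2) by (intro ln_mono) (auto simp: card_gt_0_iff)
    also have "\<dots> = ln (L ^ n) + ln (1 / \<delta> + 1)" 
      using L \<delta>(1) by (intro ln_mult_pos) (auto intro!: add_pos_pos)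
    also have "\<dots> = real n * ln L + ln (1 / \<delta> + 1)" using L by (simp add: ln_realpow)
    finally show ?thesis using n by (simp add: field_simps)
  qed
  have "limsup (\<lambda>n. SUP E\<in>{E. E \<subseteq> {0..1} \<and> finite E \<and> separated_set f n \<epsilon> E}. ereal (ln (real (card E)) / real n))
      \<le> limsup (\<lambda>n. ereal (ln L + ln (1 / \<delta> + 1) / real n))"
    using bound by (intro Limsup_mono eventually_mono[OF eventually_gt_at_top[of 0]] SUP_least) auto
  also have "(\<lambda>n. ln L + ln (1 / \<delta> + 1) / real n) \<longlonglongrightarrow> ln L + 0"
    by (intro tendsto_add tendsto_const lim_const_over_n)
  then have "limsup (\<lambda>n. ereal (ln L + ln (1 / \<delta> + 1) / real n)) = ereal (ln L)"
    by (intro lim_imp_Limsup) auto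
  finally show "limsup (\<lambda>n. SUP E\<in>{E. E \<subseteq> {0..1} \<and> finite E \<and> separated_set f n \<epsilon> E}. ereal (ln (real (card E)) / real n)) \<le> ereal (ln L)" .
qed

section \<open>Laps over a gap of the partition set\<close>

lemma mono_on_closed_interval:
  fixes g :: "real \<Rightarrow> real"
  assumes cont: "continuous_on {a..b} g" and mono: "mono_on {a<..<b} g"
  shows "mono_on {a..b} g"
proof (rule mono_onI)
  fix x y assume xy: "x \<in> {a..b}" "y \<in> {a..b}" "x \<le> y"
  show "g x \<le> g y"
  proof (cases "x = y")
    case False
    \<comment> \<open>The endpoints are approached from inside; \<open>k + 3\<close> makes each step
      less than half of \<open>y - x\<close>, so the approximations stay interior and in
      order.\<close>
    define h where "h = (\<lambda>k. (y - x) / real (k + 3))"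
    have h: "0 < h k" "h k < (y - x) / 2" for k
    proof -
      show "0 < h k" using False xy by (simp add: h_def)
      show "h k < (y - x) / 2"
        unfolding h_def using False xy by (intro divide_strict_left_mono) auto
    qed
    have "h \<longlonglongrightarrow> 0"
      unfolding h_def using LIMSEQ_ignore_initial_segment[OF lim_const_over_n[of "y - x"], of 3] by simp
    then have "(\<lambda>k. x + h k) \<longlonglongrightarrow> x + 0" "(\<lambda>k. y - h k) \<longlonglongrightarrow> y - 0" by (intro tendsto_intros; assumption)+
    then have lim: "(\<lambda>k. x + h k) \<longlonglongrightarrow> x" "(\<lambda>k. y - h k) \<longlonglongrightarrow> y" by simp_all
    have mem: "x + h k \<in> {a<..<b}" "y - h k \<in> {a<..<b}" "x + h k \<le> y - h k" for k
    proof -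
      show "x + h k \<in> {a<..<b}" "y - h k \<in> {a<..<b}" "x + h k \<le> y - h k"
        using h[of k] xy by auto
    qed
    have mem': "x + h k \<in> {a..b}" "y - h k \<in> {a..b}" for k
      using mem[of k] by auto
    have "(\<lambda>k. g (x + h k)) \<longlonglongrightarrow> g x" "(\<lambda>k. g (y - h k)) \<longlonglongrightarrow> g y"
      using continuous_on_tendsto_compose[OF cont lim(1) xy(1)]
        continuous_on_tendsto_compose[OF cont lim(2) xy(2)] mem' by auto
    then show ?thesis
      using mono_onD[OF mono mem(1) mem(2) mem(3)] by (intro LIMSEQ_le) auto
  qed simp
qed

text \<open>\<open>w\<close> is the first point with value \<open>g t\<close>, and \<open>z\<close>
  the last point before \<open>w\<close> with value \<open>g s\<close>. By the intermediate value
  theorem, leaving the open range of values in between would give an earlier \<open>w\<close> or a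
  later \<open>z\<close>.\<close>

lemma increasing_crossing:
  fixes g :: "real \<Rightarrow> real"
  assumes st: "s \<le> t" and cont: "continuous_on {s..t} g" and lt: "g s < g t"
  obtains z w where "s \<le> z" "z < w" "w \<le> t" "g z = g s" "g w = g t" "g ` {z<..<w} \<subseteq> {g s<..<g t}"
proof -
  define W where "W = {x\<in>{s..t}. g x = g t}"
  have "compact W"
    unfolding W_def compact_eq_bounded_closed
    by (intro conjI bounded_subset[OF bounded_closed_interval[of s t]] continuous_closed_preimage_constant cont) auto
  moreover have "W \<noteq> {}" using st by (auto simp: W_def)
  ultimately obtain w where w: "w \<in> W" "\<And>x. x \<in> W \<Longrightarrow> w \<le> x" by (meson compact_attains_inf)
  have ws: "s \<le> w" "w \<le> t" "g w = g t" using w by (auto simp: W_def)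
  have cont': "continuous_on {s..w} g" using cont ws by (auto intro: continuous_on_subset)
  define Z where "Z = {x\<in>{s..w}. g x = g s}"
  have "compact Z"
    unfolding Z_def compact_eq_bounded_closed
    by (intro conjI bounded_subset[OF bounded_closed_interval[of s w]] continuous_closed_preimage_constant cont') auto
  moreover have "Z \<noteq> {}" using ws by (auto simp: Z_def)
  ultimately obtain z where z: "z \<in> Z" "\<And>x. x \<in> Z \<Longrightarrow> x \<le> z" by (meson compact_attains_sup)
  have zs: "s \<le> z" "z \<le> w" "g z = g s" using z by (auto simp: Z_def)
  have "z < w" using zs ws lt by (cases "z = w") auto
  moreover have "g x \<in> {g s<..<g t}" if x: "z < x" "x < w" for x
  proof -
    have "g x < g t"
    proof (rule ccontr)
      assume "\<not> g x < g t"
      then obtain c where "s \<le> c" "c \<le> x" "g c = g t"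
        using IVT'[of g s "g t" x] lt x zs ws continuous_on_subset[OF cont', of "{s..x}"] by auto
      then show False using w(2)[of c] x ws by (auto simp: W_def)
    qed
    moreover have "g s < g x"
    proof (rule ccontr)
      assume "\<not> g s < g x"
      then obtain c where "x \<le> c" "c \<le> w" "g c = g s"
        using IVT'[of g x "g s" w] lt x zs ws continuous_on_subset[OF cont', of "{x..w}"] by auto
      then show False using z(2)[of c] x zs by (auto simp: Z_def)
    qed
    ultimately show ?thesis by simp
  qed
  ultimately show ?thesis using zs ws by (intro that[of z w]) auto
qed

lemma crossing:
  fixes g :: "real \<Rightarrow> real"
  assumes st: "s \<le> t" and cont: "continuous_on {s..t} g" and ne: "g s \<noteq> g t"
  obtains z w where "s \<le> z" "z < w" "w \<le> t" "{g z, g w} = {g s, g t}"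
    "g ` {z<..<w} \<subseteq> {min (g s) (g t)<..<max (g s) (g t)}"
proof (cases "g s < g t")
  case True
  then obtain z w where "s \<le> z" "z < w" "w \<le> t" "g z = g s" "g w = g t" "g ` {z<..<w} \<subseteq> {g s<..<g t}"
    using increasing_crossing[OF st cont] by blast
  with True that[of z w] show ?thesis by simp
next
  case False
  with ne have "- g s < - g t" by simp
  moreover have "continuous_on {s..t} (\<lambda>x. - g x)" using cont by (rule continuous_on_minus)
  ultimately obtain z w where zw: "s \<le> z" "z < w" "w \<le> t" "- g z = - g s" "- g w = - g t"
      "(\<lambda>x. - g x) ` {z<..<w} \<subseteq> {- g s<..<- g t}"
    using increasing_crossing[OF st, of "\<lambda>x. - g x"] by blast
  show ?thesis using zw False ne by (intro that[of z w]) (force simp: image_subset_iff)+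
qed

section \<open>Existence, disjointness and monotonicity of laps\<close>

locale partition_gap =
  fixes f :: "real \<Rightarrow> real" and P :: "real set" and p q :: real
  assumes interval_map: "interval_map f"
    and partition: "partition_set f P"
    and pq: "p \<in> P" "q \<in> P" "p < q" "{p<..<q} \<inter> P = {}"
begin

text \<open>A lap is a component \<open>(a,b)\<close> of the preimage of the gap, stored by its endpoints.\<close>

definition laps :: "nat \<Rightarrow> (real \<times> real) set" where
  "laps n = {(a, b). 0 \<le> a \<and> a < b \<and> b \<le> 1 \<and> (f ^^ n) a \<notin> {p<..<q} \<and> (f ^^ n) b \<notin> {p<..<q}
     \<and> (f ^^ n) ` {a<..<b} \<subseteq> {p<..<q}}"

lemma pq_bounds: "0 \<le> p" "q \<le> 1"
  using partition pq by (auto simp: partition_set_def)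

lemma endpoints_not_in_gap: "(f ^^ n) 0 \<notin> {p<..<q}" "(f ^^ n) 1 \<notin> {p<..<q}"
proof -
  have "(f ^^ n) x \<in> P" if "x \<in> P" for x
    using partition that by (induction n) (auto simp: partition_set_def)
  then show "(f ^^ n) 0 \<notin> {p<..<q}" "(f ^^ n) 1 \<notin> {p<..<q}"
    using partition pq(4) by (auto simp: partition_set_def)
qed

text \<open>\<open>a\<close> and \<open>b\<close> are the points nearest to \<open>z\<close> on
  either side that \<open>f ^^ n\<close> maps outside the gap; \<open>0\<close> and \<open>1\<close>
  are candidates because their orbits stay in \<open>P\<close>.\<close>

lemma ex_lap:
  assumes z: "z \<in> {0..1}" "(f ^^ n) z \<in> {p<..<q}"
  obtains a b where "(a, b) \<in> laps n" "a < z" "z < b"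
proof -
  note cont = continuous_on_funpow_interval[OF interval_map, of n]
  define S where "S = {0..1} \<inter> (f ^^ n) -` (- {p<..<q})"
  have S: "closed S" unfolding S_def by (intro continuous_closed_preimage cont) auto
  define Z where "Z = S \<inter> {..z}"
  define W where "W = S \<inter> {z..}"
  have bdd: "bounded S" by (rule bounded_subset[OF bounded_closed_interval[of 0 1]]) (auto simp: S_def)
  have "compact Z" "compact W"
    unfolding Z_def W_def compact_eq_bounded_closed using S bdd by (auto intro: bounded_subset)
  moreover have "0 \<in> Z" "1 \<in> W" using endpoints_not_in_gap z by (auto simp: Z_def W_def S_def)
  ultimately obtain a b where a: "a \<in> Z" "\<And>x. x \<in> Z \<Longrightarrow> x \<le> a" and b: "b \<in> W" "\<And>x. x \<in> W \<Longrightarrow> b \<le> x"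
    by (metis compact_attains_inf compact_attains_sup empty_iff)
  have ab: "0 \<le> a" "a \<le> z" "z \<le> b" "b \<le> 1" "(f ^^ n) a \<notin> {p<..<q}" "(f ^^ n) b \<notin> {p<..<q}"
    using a(1) b(1) by (auto simp: Z_def W_def S_def)
  then have "a < z" "z < b" using z by (auto simp: less_le)
  moreover have "(f ^^ n) x \<in> {p<..<q}" if "x \<in> {a<..<b}" for x
  proof (rule ccontr)
    assume "(f ^^ n) x \<notin> {p<..<q}"
    then have "x \<in> S" using that ab by (auto simp: S_def)
    then have "x \<in> Z \<or> x \<in> W" by (auto simp: Z_def W_def)
    then show False using a(2)[of x] b(2)[of x] that by auto
  qed
  ultimately show ?thesis using ab by (intro that[of a b]) (auto simp: laps_def)
qed

text \<open>If overlapping laps differed, an endpoint of one would lie inside the other, where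
  \<open>f ^^ n\<close> takes values in the gap.\<close>

lemma lap_disjoint:
  assumes "(a, b) \<in> laps n" "(c, d) \<in> laps n" "x \<in> {a<..<b}" "x \<in> {c<..<d}"
  shows "(a, b) = (c, d)"
proof -
  have "\<not> a < c" "\<not> c < a" "\<not> b < d" "\<not> d < b"
    using assms unfolding laps_def image_subset_iff by fastforce+
  then show ?thesis by simp
qed

lemma ex_lap_interval:
  assumes st: "0 \<le> s" "s < t" "t \<le> 1" "(f ^^ n) ` {s<..<t} \<subseteq> {p<..<q}"
  obtains a b where "(a, b) \<in> laps n" "a \<le> s" "t \<le> b"
proof -
  define z where "z = (s + t) / 2"
  have z: "s < z" "z < t" using st by (auto simp: z_def)
  then obtain a b where ab: "(a, b) \<in> laps n" "a < z" "z < b"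
    using st by (elim ex_lap[of z n, rotated -1]) (auto simp: image_subset_iff)
  have "\<not> s < a" "\<not> b < t"
    using ab z st unfolding laps_def image_subset_iff by fastforce+
  then show ?thesis using ab that by auto
qed

text \<open>Here the Markov property enters. As \<open>P\<close> is forward invariant and misses the
  gap, no iterate up to \<open>n\<close> of an inner point of the lap hits \<open>P\<close>. Each
  image of the open lap is connected, hence stays in one component, where \<open>f\<close> is
  monotone.\<close>

lemma lap_monotone:
  assumes ab: "(a, b) \<in> laps n"
  shows "mono_on {a..b} (f ^^ n) \<or> antimono_on {a..b} (f ^^ n)"
proof -
  have a: "0 \<le> a" "a < b" "b \<le> 1" and im: "(f ^^ n) ` {a<..<b} \<subseteq> {p<..<q}"
    using ab by (auto simp: laps_def)
  have sub: "{a<..<b} \<subseteq> {0..1}" using a by auto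
  have notP: "(f ^^ i) x \<notin> P" if "x \<in> {a<..<b}" "i \<le> n" for x i
  proof
    assume *: "(f ^^ i) x \<in> P"
    have "(f ^^ (k + i)) x \<in> P" for k
      using * partition by (induction k) (auto simp: partition_set_def)
    from this[of "n - i"] that have "(f ^^ n) x \<in> P" by simp
    then show False using im that pq(4) by blast
  qed
  have "mono_on {a<..<b} (f ^^ i) \<or> antimono_on {a<..<b} (f ^^ i)" if "i \<le> n" for i
    using that
  proof (induction i)
    case 0
    then show ?case by (auto simp: monotone_on_def)
  next
    case (Suc i)
    let ?K = "(f ^^ i) ` {a<..<b}"
    have "connected ?K"
      using continuous_on_subset[OF continuous_on_funpow_interval[OF interval_map] sub]
      by (intro connected_continuous_image) auto
    moreover have "?K \<subseteq> {0..1} - P"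
    proof (rule image_subsetI)
      fix x assume x: "x \<in> {a<..<b}"
      then have "x \<in> {0..1}" using sub by blast
      then show "(f ^^ i) x \<in> {0..1} - P"
        using funpow_in_interval[OF interval_map] notP[OF x, of i] Suc.prems by simp
    qed
    moreover have "?K \<noteq> {}" using a by auto
    ultimately obtain I where I: "I \<in> components ({0..1} - P)" "?K \<subseteq> I"
      using exists_component_superset[of ?K "{0..1} - P"] by blast
    then have "mono_on I f \<or> antimono_on I f" using partition by (auto simp: partition_set_def)
    then have "mono_on ?K f \<or> antimono_on ?K f" using I(2) by (meson monotone_on_subset)
    moreover have "mono_on {a<..<b} (f ^^ i) \<or> antimono_on {a<..<b} (f ^^ i)" using Suc by simp
    ultimately show ?case
      unfolding funpow.simps monotone_on_def by (elim disjE) simp_all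
  qed
  from this[of n, simplified] show ?thesis
  proof
    assume "mono_on {a<..<b} (f ^^ n)"
    then show ?thesis using mono_on_closed_interval a
        continuous_on_subset[OF continuous_on_funpow_interval[OF interval_map]] by auto
  next
    assume "antimono_on {a<..<b} (f ^^ n)"
    then have "mono_on {a<..<b} (\<lambda>x. - (f ^^ n) x)" by (auto simp: monotone_on_def)
    moreover have "continuous_on {a..b} (\<lambda>x. - (f ^^ n) x)"
      using a by (intro continuous_on_minus continuous_on_subset[OF continuous_on_funpow_interval[OF interval_map]]) auto
    ultimately have "mono_on {a..b} (\<lambda>x. - (f ^^ n) x)" by (intro mono_on_closed_interval)
    then show ?thesis by (auto simp: monotone_on_def)
  qed
qed

text \<open>Laps are full branches: the ends map into \<open>{p..q}\<close> by continuity, but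
  outside the open gap. Were the two values equal, monotonicity would make \<open>f ^^ n\<close>
  constant on the lap, with a value outside the gap.\<close>

lemma lap_endpoints:
  assumes ab: "(a, b) \<in> laps n"
  shows "{(f ^^ n) a, (f ^^ n) b} = {p, q}"
proof -
  have a: "0 \<le> a" "a < b" "b \<le> 1" and im: "(f ^^ n) ` {a<..<b} \<subseteq> {p<..<q}"
    and out: "(f ^^ n) a \<notin> {p<..<q}" "(f ^^ n) b \<notin> {p<..<q}"
    using ab by (auto simp: laps_def)
  have "(f ^^ n) ` closure {a<..<b} \<subseteq> closure {p<..<q}"
    using a im by (intro image_closure_subset continuous_on_subset[OF continuous_on_funpow_interval[OF interval_map]])
      (auto intro: closure_subset[THEN subsetD])
  then have "(f ^^ n) ` {a..b} \<subseteq> {p..q}" using a pq by simp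
  with a have "(f ^^ n) a \<in> {p..q}" "(f ^^ n) b \<in> {p..q}" by (auto simp: image_subset_iff)
  with out have "(f ^^ n) a \<in> {p, q}" "(f ^^ n) b \<in> {p, q}" by auto
  moreover have "(f ^^ n) a \<noteq> (f ^^ n) b"
  proof
    assume eq: "(f ^^ n) a = (f ^^ n) b"
    let ?z = "(a + b) / 2"
    have z: "?z \<in> {a..b}" "?z \<in> {a<..<b}" "a \<in> {a..b}" "b \<in> {a..b}" "a \<le> ?z" "?z \<le> b" using a by auto
    have "(f ^^ n) ?z = (f ^^ n) a"
      using lap_monotone[OF ab] z(1,3-) eq unfolding monotone_on_def by (metis order_antisym)
    then show False using im out z(2) by (metis imageI subsetD)
  qed
  ultimately show ?thesis by auto
qed

section \<open>Variation of the iterates inside the laps\<close>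

definition lap_var :: "nat \<Rightarrow> real \<times> real \<Rightarrow> real \<Rightarrow> real" where
  "lap_var n = (\<lambda>(a, b) x. \<bar>(f ^^ n) (max a (min b x)) - (f ^^ n) a\<bar>)"

text \<open>Since \<open>f ^^ n\<close> is monotone on the closed lap, its variation over a piece is
  the distance of two values. So \<open>lap_var n K x\<close> is the variation over the part of
  \<open>K\<close> left of \<open>x\<close>, and it is additive.\<close>

lemma lap_var_diff:
  assumes "(a, b) \<in> laps n" "x \<le> y"
  shows "lap_var n (a, b) y - lap_var n (a, b) x = \<bar>(f ^^ n) (max a (min b y)) - (f ^^ n) (max a (min b x))\<bar>"
proof -
  have "a < b" using assms by (auto simp: laps_def)
  let ?x = "max a (min b x)" and ?y = "max a (min b y)"
  have xy: "a \<in> {a..b}" "?x \<in> {a..b}" "?y \<in> {a..b}" "a \<le> ?x" "?x \<le> ?y" "a \<le> ?y" using \<open>a < b\<close> assms(2) by auto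
  from lap_monotone[OF assms(1)] show ?thesis
  proof
    assume *: "mono_on {a..b} (f ^^ n)"
    show ?thesis
      using mono_onD[OF * xy(1,2,4)] mono_onD[OF * xy(2,3,5)] by (simp add: lap_var_def)
  next
    assume *: "antimono_on {a..b} (f ^^ n)"
    show ?thesis
      using monotone_onD[OF * xy(1,2,4)] monotone_onD[OF * xy(2,3,5)] by (simp add: lap_var_def)
  qed
qed

lemma lap_var_mono: "K \<in> laps n \<Longrightarrow> x \<le> y \<Longrightarrow> lap_var n K x \<le> lap_var n K y"
  using lap_var_diff[of "fst K" "snd K" n x y] by simp

lemma lap_var_diff_ge:
  assumes ab: "(a, b) \<in> laps n" and "x \<le> z" "z \<le> w" "w \<le> y" "a \<le> z" "w \<le> b"
  shows "\<bar>(f ^^ n) w - (f ^^ n) z\<bar> \<le> lap_var n (a, b) y - lap_var n (a, b) x"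
proof -
  have "\<bar>(f ^^ n) w - (f ^^ n) z\<bar> = lap_var n (a, b) w - lap_var n (a, b) z"
    using assms by (simp add: lap_var_diff[OF ab])
  then show ?thesis using lap_var_mono[OF ab, of x z] lap_var_mono[OF ab, of w y] assms by simp
qed

lemma lap_var_0: "K \<in> laps n \<Longrightarrow> lap_var n K 0 = 0"
  by (auto simp: lap_var_def laps_def)

lemma lap_var_1: "K \<in> laps n \<Longrightarrow> lap_var n K 1 = q - p"
  using lap_endpoints[of "fst K" "snd K" n] pq
  by (auto simp: lap_var_def laps_def doubleton_eq_iff max_def min_def)

lemma continuous_on_lap_var:
  assumes "K \<in> laps n"
  shows "continuous_on {0..1} (lap_var n K)"
proof -
  obtain a b where K: "K = (a, b)" "0 \<le> a" "a < b" "b \<le> 1" using assms by (auto simp: laps_def)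
  have "continuous_on {0..1} (\<lambda>x. (f ^^ n) (max a (min b x)))"
    using K by (intro continuous_on_compose2[OF continuous_on_funpow_interval[OF interval_map]] continuous_intros) auto
  then show ?thesis unfolding lap_var_def K by (auto intro!: continuous_intros)
qed

text \<open>On \<open>[x,y]\<close> the map \<open>f\<close> crosses the part of \<open>K\<close>
  between \<open>u\<close> and \<open>v\<close>, so some \<open>{z<..<w}\<close> is mapped into that
  part with its ends going to the ends. It lies in a lap of level \<open>Suc n\<close>, which has at
  least this variation. The point \<open>t\<close> records that this lap belongs to
  \<open>K\<close>.\<close>

lemma lap_subset_image:
  assumes K: "K \<in> laps n" and xy: "x \<in> {0..1}" "y \<in> {0..1}" "x \<le> y"
    and u: "u = min (f x) (f y)" and v: "v = max (f x) (f y)"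
    and ne: "lap_var n K u \<noteq> lap_var n K v"
  obtains a b t where "(a, b) \<in> laps (Suc n)" "t \<in> {a<..<b}" "f t \<in> {fst K<..<snd K}"
    "lap_var n K v - lap_var n K u \<le> lap_var (Suc n) (a, b) y - lap_var (Suc n) (a, b) x"
proof -
  obtain c d where cd: "K = (c, d)" by (cases K)
  have c: "0 \<le> c" "c < d" "d \<le> 1" "(f ^^ n) ` {c<..<d} \<subseteq> {p<..<q}" using K cd by (auto simp: laps_def)
  \<comment> \<open>\<open>[U,V]\<close> is the part of the closed lap inside \<open>[u,v]\<close>;
    it is nondegenerate because of \<open>ne\<close>.\<close>
  define U V where "U = max c (min d u)" and "V = max c (min d v)"
  have uv: "u \<le> v" using u v by simp
  have "U \<noteq> V" using ne cd by (auto simp: lap_var_def U_def V_def)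
  then have uv': "u \<le> U" "U < V" "V \<le> v" "c \<le> U" "V \<le> d" using uv c by (auto simp: U_def V_def)
  have cont: "continuous_on {x..y} f"
    using interval_map xy by (auto simp: interval_map_def intro: continuous_on_subset)
  have ivt: "\<exists>s\<in>{x..y}. f s = r" if "u \<le> r" "r \<le> v" for r
  proof -
    have "connected (f ` {x..y})" by (intro connected_continuous_image cont) auto
    moreover have "u \<in> f ` {x..y}" "v \<in> f ` {x..y}" using u v xy by (auto simp: min_def max_def)
    ultimately show ?thesis using connectedD_interval[of "f ` {x..y}" u v r] that by blast
  qed
  obtain s t where st: "s \<in> {x..y}" "t \<in> {x..y}" "f s = U" "f t = V"
    using ivt[of U] ivt[of V] uv' by auto
  define s' t' where "s' = min s t" and "t' = max s t"
  have st': "x \<le> s'" "s' \<le> t'" "t' \<le> y" "{f s', f t'} = {U, V}"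
    using st by (auto simp: s'_def t'_def min_def max_def)
  have "continuous_on {s'..t'} f" using cont st' by (auto intro: continuous_on_subset)
  moreover have "f s' \<noteq> f t'" using st'(4) uv' by (metis insert_absorb2 doubleton_eq_iff less_irrefl)
  ultimately obtain z w where zw: "s' \<le> z" "z < w" "w \<le> t'" "{f z, f w} = {f s', f t'}"
      "f ` {z<..<w} \<subseteq> {min (f s') (f t')<..<max (f s') (f t')}"
    using crossing[OF st'(2)] by blast
  have mm: "min (f s') (f t') = U" "max (f s') (f t') = V" 
    using st'(4) uv'(2) by (auto simp: doubleton_eq_iff)
  have img: "f r \<in> {U<..<V}" if "r \<in> {z<..<w}" for r using zw(5) that unfolding mm by blast
  have img': "f r \<in> {c<..<d}" if "r \<in> {z<..<w}" for r using img[OF that] uv'(4,5) by auto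
  have "(f ^^ Suc n) r \<in> {p<..<q}" if "r \<in> {z<..<w}" for r
    using c(4) img'[OF that] by (auto simp: funpow_swap1 image_subset_iff)
  then have "(f ^^ Suc n) ` {z<..<w} \<subseteq> {p<..<q}" by blast
  then obtain a b where ab: "(a, b) \<in> laps (Suc n)" "a \<le> z" "w \<le> b"
    using zw st' xy by (elim ex_lap_interval[of z w "Suc n", rotated -1]) (auto simp del: funpow.simps)
  have "lap_var n K v - lap_var n K u = \<bar>(f ^^ n) V - (f ^^ n) U\<bar>"
    unfolding cd U_def V_def by (rule lap_var_diff[OF K[unfolded cd] uv])
  also have "\<dots> = \<bar>(f ^^ Suc n) w - (f ^^ Suc n) z\<bar>"
    using zw(4) unfolding st'(4) by (auto simp: doubleton_eq_iff funpow_Suc_right abs_minus_commute simp del: funpow.simps)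
  also have "\<dots> \<le> lap_var (Suc n) (a, b) y - lap_var (Suc n) (a, b) x"
    using zw st' ab by (intro lap_var_diff_ge) auto
  finally have "lap_var n K v - lap_var n K u \<le> lap_var (Suc n) (a, b) y - lap_var (Suc n) (a, b) x" .
  moreover have "(z + w) / 2 \<in> {z<..<w}" using zw by auto
  ultimately show ?thesis using img' ab cd by (intro that[of a b "(z + w) / 2"]) auto
qed

text \<open>The image under \<open>f\<close> of the lap \<open>(a, b)\<close> is connected and
  contains no end of a lap of level \<open>n\<close>, since \<open>f ^^ n\<close> sends the image
  into the gap and the ends outside it.\<close>

lemma lap_image_unique:
  assumes ab: "(a, b) \<in> laps (Suc n)" and "s \<in> {a<..<b}" "t \<in> {a<..<b}"
    and K: "K \<in> laps n" "L \<in> laps n" "f s \<in> {fst K<..<snd K}" "f t \<in> {fst L<..<snd L}"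
  shows "K = L"
proof -
  have a: "0 \<le> a" "b \<le> 1" and im: "(f ^^ Suc n) ` {a<..<b} \<subseteq> {p<..<q}" using ab by (auto simp: laps_def)
  have con: "connected (f ` {a<..<b})"
    using interval_map a
    by (intro connected_continuous_image) (auto simp: interval_map_def intro: continuous_on_subset)
  have img: "(f ^^ n) r \<in> {p<..<q}" if "r \<in> f ` {a<..<b}" for r
    using that im by (auto simp: funpow_swap1)
  have st: "f s \<in> f ` {a<..<b}" "f t \<in> f ` {a<..<b}" using assms by auto
  have "(f ^^ n) (fst K) \<notin> {p<..<q}" "(f ^^ n) (snd K) \<notin> {p<..<q}" using K by (auto simp: laps_def)
  then have "fst K \<notin> f ` {a<..<b}" "snd K \<notin> f ` {a<..<b}" using img by blast+
  then have "f t \<in> {fst K<..<snd K}"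
    using connectedD_interval[OF con st(1) st(2)] connectedD_interval[OF con st(2) st(1)] K(3)
    by (metis greaterThanLessThan_iff linorder_not_less order_less_imp_le)
  then show ?thesis
    using lap_disjoint[of "fst K" "snd K" n "fst L" "snd L" "f t"] K by simp
qed

text \<open>This is \<open>V\<^sub>n\<close> of the overview. An infinite sum would be
  \<open>0\<close> by convention, so finiteness of \<open>laps n\<close> is assumed until the
  entropy provides it.\<close>

definition total_var :: "nat \<Rightarrow> real \<Rightarrow> real" where
  "total_var n x = (\<Sum>K\<in>laps n. lap_var n K x)"

text \<open>Every part of a lap of level \<open>n\<close> covered by \<open>f\<close> on \<open>[x,y]\<close> is the image of a part of a lap of level
  \<open>n + 1\<close>, and different laps need different preimages.\<close>

lemma total_var_step:
  assumes fin: "finite (laps n)" "finite (laps (Suc n))"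
    and xy: "x \<in> {0..1}" "y \<in> {0..1}" "x \<le> y"
  shows "\<bar>total_var n (f x) - total_var n (f y)\<bar> \<le> total_var (Suc n) y - total_var (Suc n) x"
proof -
  define u v where "u = min (f x) (f y)" and "v = max (f x) (f y)"
  \<comment> \<open>Laps outside \<open>S\<close> contribute nothing; each lap in \<open>S\<close>
    is assigned a lap of level \<open>Suc n\<close> that determines it.\<close>
  define S where "S = {K\<in>laps n. lap_var n K u \<noteq> lap_var n K v}"
  let ?D = "\<lambda>K. lap_var n K v - lap_var n K u"
  let ?E = "\<lambda>K. lap_var (Suc n) K y - lap_var (Suc n) K x"
  have "\<forall>K\<in>S. \<exists>L. L \<in> laps (Suc n) \<and> ?D K \<le> ?E L \<and> (\<exists>t\<in>{fst L<..<snd L}. f t \<in> {fst K<..<snd K})"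
  proof
    fix K assume "K \<in> S"
    then have "K \<in> laps n" "lap_var n K u \<noteq> lap_var n K v" by (auto simp: S_def)
    from lap_subset_image[OF this(1) xy u_def v_def this(2)]
    show "\<exists>L. L \<in> laps (Suc n) \<and> ?D K \<le> ?E L \<and> (\<exists>t\<in>{fst L<..<snd L}. f t \<in> {fst K<..<snd K})"
      by (metis fst_conv snd_conv)
  qed
  from bchoice[OF this] obtain h where h: "\<And>K. K \<in> S \<Longrightarrow> h K \<in> laps (Suc n)" "\<And>K. K \<in> S \<Longrightarrow> ?D K \<le> ?E (h K)"
      "\<And>K. K \<in> S \<Longrightarrow> \<exists>t\<in>{fst (h K)<..<snd (h K)}. f t \<in> {fst K<..<snd K}"
    by auto
  have inj: "inj_on h S"
  proof (rule inj_onI)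
    fix K L assume KL: "K \<in> S" "L \<in> S" "h K = h L"
    from h(3)[OF KL(1)] h(3)[OF KL(2)] obtain s t where
      "s \<in> {fst (h K)<..<snd (h K)}" "f s \<in> {fst K<..<snd K}"
      "t \<in> {fst (h K)<..<snd (h K)}" "f t \<in> {fst L<..<snd L}" using KL(3) by auto
    moreover have "(fst (h K), snd (h K)) \<in> laps (Suc n)" using h(1)[OF KL(1)] by simp
    ultimately show "K = L" using KL by (intro lap_image_unique[of "fst (h K)" "snd (h K)" n s t]) (auto simp: S_def)
  qed
  have "\<bar>total_var n (f x) - total_var n (f y)\<bar> = \<bar>total_var n v - total_var n u\<bar>"
    by (auto simp: u_def v_def min_def max_def)
  also have "\<dots> = \<bar>\<Sum>K\<in>laps n. ?D K\<bar>" by (simp add: total_var_def sum_subtractf)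
  also have "(\<Sum>K\<in>laps n. ?D K) = (\<Sum>K\<in>S. ?D K)"
    using fin by (intro sum.mono_neutral_right) (auto simp: S_def)
  also have "\<bar>\<Sum>K\<in>S. ?D K\<bar> = (\<Sum>K\<in>S. ?D K)"
    by (intro abs_of_nonneg sum_nonneg) (auto simp: S_def u_def v_def intro!: lap_var_mono)
  also have "\<dots> \<le> (\<Sum>K\<in>S. ?E (h K))" using h(2) by (rule sum_mono)
  also have "\<dots> = (\<Sum>L\<in>h ` S. ?E L)" by (simp add: sum.reindex[OF inj])
  also have "\<dots> \<le> (\<Sum>L\<in>laps (Suc n). ?E L)"
    using fin(2) h(1) xy by (intro sum_mono2) (auto intro!: lap_var_mono)
  also have "\<dots> = total_var (Suc n) y - total_var (Suc n) x" by (simp add: total_var_def sum_subtractf)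
  finally show ?thesis .
qed

text \<open>Take a lap around a point whose value is the midpoint of the gap. If its variation did
  not grow from \<open>x\<close> to \<open>y\<close>, then \<open>f ^^ n\<close> would be constant
  on its common part with \<open>[x,y]\<close>. The lap ends have other values, so
  \<open>[x,y]\<close> would lie inside the lap and have a one-point image.\<close>

lemma total_var_strict:
  assumes fin: "finite (laps n)" and xy: "x \<in> {0..1}" "y \<in> {0..1}" "x < y"
    and onto: "(f ^^ n) ` {x..y} = {0..1}"
  shows "total_var n x < total_var n y"
proof -
  let ?r = "(p + q) / 2"
  have r: "?r \<in> {p<..<q}" using pq by auto
  then have "?r \<in> (f ^^ n) ` {x..y}" unfolding onto using pq_bounds by auto
  then obtain z where z: "z \<in> {x..y}" "(f ^^ n) z = ?r" by auto
  then obtain a b where ab: "(a, b) \<in> laps n" "a < z" "z < b"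
    using ex_lap[of z n] xy r by (metis atLeastAtMost_iff order_trans)
  have "lap_var n (a, b) x \<noteq> lap_var n (a, b) y"
  proof
    assume eq: "lap_var n (a, b) x = lap_var n (a, b) y"
    have same: "(f ^^ n) w = ?r" if w: "w \<in> {a..b}" "w \<in> {x..y}" for w
    proof -
      have *: "\<bar>(f ^^ n) (max w z) - (f ^^ n) (min w z)\<bar> \<le> 0"
        using lap_var_diff_ge[OF ab(1), of x "min w z" "max w z" y] eq w z ab by auto
      then show ?thesis using z(2) by (auto simp: min_def max_def split: if_splits)
    qed
    have out: "(f ^^ n) a \<noteq> ?r" "(f ^^ n) b \<noteq> ?r" using ab(1) r unfolding laps_def by (metis (no_types, lifting) case_prodD mem_Collect_eq)+
    have "a < x" "y < b" using same[of a] same[of b] out ab z by (auto simp: not_le[symmetric] simp del: not_le)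
    then have "(f ^^ n) ` {x..y} \<subseteq> {?r}" using same by auto
    then show False unfolding onto using r pq_bounds by (auto simp: subset_singleton_iff)
  qed
  with lap_var_mono[OF ab(1), of x y] xy have "lap_var n (a, b) x < lap_var n (a, b) y" by simp
  then show ?thesis
    unfolding total_var_def using fin ab(1) xy by (intro sum_strict_mono_ex1) (auto intro!: lap_var_mono)
qed

text \<open>Since \<open>f ^^ m\<close> leads from the gap to every lap, the laps of level
  \<open>n\<close> form a horseshoe for \<open>f ^^ (n + m)\<close>. The smaller interval
  \<open>[p',q']\<close> avoids the lap ends, which neighbouring laps may share.\<close>

lemma card_laps_le:
  assumes h: "topological_entropy {0..1} f = ereal h"
    and p': "p < p'" "p' < q'" "q' < q"
    and onto: "(f ^^ m) ` {p'<..<q'} = {0..1}"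
  shows "finite (laps n) \<and> real (card (laps n)) \<le> exp (real (n + m) * h)"
proof -
  have hnn: "0 \<le> h" using topological_entropy_nonneg[of "{0..1}" f] h by simp
  have "m \<noteq> 0"
  proof
    assume "m = 0"
    with onto have "{p'<..<q'} = {0..1}" by simp
    then have "0 \<in> {p'<..<q'}" by simp
    then show False using p' pq_bounds by auto
  qed
  let ?J = "{p'..q'}"
  have J01: "?J \<subseteq> {0..1}" using p' pq_bounds by auto
  have bound: "real (card I) \<le> exp (real (n + m) * h)" if I: "finite I" "I \<subseteq> laps n" for I
  proof (cases "I = {}")
    case False
    \<comment> \<open>The route goes from \<open>?J\<close> into the lap \<open>K\<close> at time
      \<open>m\<close> and back to \<open>?J\<close> at time \<open>n + m\<close>. The return
      condition makes the sets of different laps disjoint.\<close>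
    define A where "A = (\<lambda>K. (?J \<inter> (f ^^ m) -` {fst K..snd K}) \<inter> (?J \<inter> (f ^^ (n + m)) -` ?J))"
    have closedA: "compact (A K)" for K
      unfolding A_def compact_eq_bounded_closed
      by (intro conjI closed_Int continuous_closed_preimage bounded_subset[OF bounded_closed_interval[of p' q']]
          continuous_on_subset[OF continuous_on_funpow_interval[OF interval_map] J01]) auto
    have img: "?J \<subseteq> (f ^^ (n + m)) ` A K" if "K \<in> laps n" for K
    proof
      fix t assume t: "t \<in> ?J"
      obtain a b where K: "K = (a, b)" by (cases K)
      have a: "0 \<le> a" "a < b" "b \<le> 1" using that K by (auto simp: laps_def)
      have "connected ((f ^^ n) ` {a..b})"
        using a by (intro connected_continuous_image continuous_on_subset[OF continuous_on_funpow_interval[OF interval_map]]) auto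
      \<comment> \<open>Being a full branch, the lap contains a preimage \<open>w\<close> of
        \<open>t\<close>; \<open>f ^^ m\<close> in turn reaches \<open>w\<close> from
        \<open>?J\<close>.\<close>
      moreover have "p \<in> {(f ^^ n) a, (f ^^ n) b}" "q \<in> {(f ^^ n) a, (f ^^ n) b}"
        using lap_endpoints that K by auto
      then have "p \<in> (f ^^ n) ` {a..b}" "q \<in> (f ^^ n) ` {a..b}" using a by auto
      ultimately have "t \<in> (f ^^ n) ` {a..b}" using connectedD_interval t p' by fastforce
      then obtain w where w: "w \<in> {a..b}" "(f ^^ n) w = t" by auto
      then have "w \<in> (f ^^ m) ` {p'<..<q'}" unfolding onto using a by auto
      then obtain x where x: "x \<in> {p'<..<q'}" "(f ^^ m) x = w" by auto
      have "(f ^^ (n + m)) x = t" using x w by (simp add: funpow_add)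
      moreover from this have "x \<in> A K" using x w K t by (auto simp: A_def)
      ultimately show "t \<in> (f ^^ (n + m)) ` A K" by blast
    qed
    have "ereal (ln (real (card I)) / real (n + m)) \<le> topological_entropy {0..1} f"
    proof (rule horseshoe_entropy[OF I(1) False, where A = A])
      show "0 < n + m" using \<open>m \<noteq> 0\<close> by simp
      show "A K \<subseteq> {0..1}" for K using J01 by (auto simp: A_def)
      show "compact (A K)" for K by (rule closedA)
      show "A K \<noteq> {}" if "K \<in> I" for K using img[of K] that I p' by auto
      show "A L \<subseteq> (f ^^ (n + m)) ` A K" if "K \<in> I" "L \<in> I" for K L
        using img[of K] that I by (auto simp: A_def)
      show "A K \<inter> A L = {}" if KL: "K \<in> I" "L \<in> I" "K \<noteq> L" for K L
      proof (rule ccontr)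
        assume "A K \<inter> A L \<noteq> {}"
        then obtain x where x: "x \<in> A K" "x \<in> A L" by auto
        obtain a b c d where K: "K = (a, b)" "L = (c, d)" by (cases K, cases L)
        define w where "w = (f ^^ m) x"
        have w: "w \<in> {a..b}" "w \<in> {c..d}" "(f ^^ n) w \<in> {p<..<q}"
          using x p' unfolding A_def K w_def by (auto simp: funpow_add)
        moreover have "(a, b) \<in> laps n" "(c, d) \<in> laps n" using KL I K by auto
        moreover from this have "w \<noteq> a" "w \<noteq> b" "w \<noteq> c" "w \<noteq> d" using w(3) by (auto simp: laps_def)
        ultimately show False using lap_disjoint[of a b n c d w] KL K by auto
      qed
    qed
    then have "ln (real (card I)) \<le> real (n + m) * h"
      unfolding h using \<open>m \<noteq> 0\<close> by (simp add: field_simps)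
    moreover have "real (card I) > 0" using False I by (simp add: card_gt_0_iff)
    ultimately show ?thesis by (metis exp_le_cancel_iff exp_ln)
  qed simp
  \<comment> \<open>Infinitely many laps would have finite subsets of any size, against the uniform
    bound.\<close>
  have "finite (laps n)"
  proof (rule ccontr)
    assume "infinite (laps n)"
    then obtain I where "I \<subseteq> laps n" "finite I" "card I = Suc (nat \<lceil>exp (real (n + m) * h)\<rceil>)"
      using infinite_arbitrarily_large by blast
    with bound[of I] show False by simp linarith
  qed
  with bound[of "laps n"] show ?thesis by simp
qed

end

section \<open>The conjugating homeomorphism\<close>

lemma openin_unit_interval:
  "0 \<le> a \<Longrightarrow> b \<le> 1 \<Longrightarrow> openin (top_of_set {0..1}) {a<..<b::real}"
  by (rule open_subset) auto

lemma (in partition_gap) lipschitz_conjugate: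
  assumes leo: "leo f" and h: "topological_entropy {0..1} f = ereal h" and lam: "exp h < L"
  shows "\<exists>(\<psi> :: real \<Rightarrow> real) (\<psi>' :: real \<Rightarrow> real). homeomorphism {0..1} {0..1} \<psi> \<psi>' \<and> lipschitz_on L {0..1} (\<psi> \<circ> f \<circ> \<psi>')"
proof -
  have lam0: "0 < L" using lam less_trans[OF exp_gt_zero] by blast
  define p' q' where "p' = (2 * p + q) / 3" and "q' = (p + 2 * q) / 3"
  have p': "p < p'" "p' < q'" "q' < q" using pq(3) by (auto simp: p'_def q'_def)
  have "openin (top_of_set {0..1}) {p'<..<q'}"
    using p' pq_bounds by (intro openin_unit_interval) auto
  moreover have "{p'<..<q'} \<noteq> {}" using p' by simp
  ultimately obtain m where m: "(f ^^ m) ` {p'<..<q'} = {0..1}" using leo unfolding leo_def by blast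
  note fin = card_laps_le[OF h p' m, THEN conjunct1]
  note card = card_laps_le[OF h p' m, THEN conjunct2]
  define T where "T = (\<lambda>n x. total_var n x / L ^ n)"
  \<comment> \<open>Each of the at most \<open>exp ((n + m) * h)\<close> laps contributes at most
    \<open>q - p\<close>; dividing by \<open>L ^ n\<close> leaves a geometric series of ratio
    \<open>exp h / L < 1\<close>.\<close>
  define M where "M = (\<lambda>n. (q - p) * exp (real m * h) * (exp h / L) ^ n)"
  have mono: "total_var n x \<le> total_var n y" if "x \<le> y" for n x y
    unfolding total_var_def using that by (intro sum_mono lap_var_mono)
  have zero: "total_var n 0 = 0" for n
    unfolding total_var_def by (simp add: lap_var_0)
  have bound: "norm (T n x) \<le> M n" if "x \<in> {0..1}" for n x
  proof -
    have "0 \<le> total_var n x" using mono[of 0 x n] zero[of n] that by simp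
    moreover have "total_var n x \<le> real (card (laps n)) * (q - p)"
      using mono[of x 1 n] that by (simp add: total_var_def lap_var_1)
    moreover have "real (card (laps n)) * (q - p) \<le> exp (real (n + m) * h) * (q - p)"
      using card[of n] pq(3) by (intro mult_right_mono) auto
    ultimately have "norm (T n x) \<le> exp (real (n + m) * h) * (q - p) / L ^ n"
      using lam0 by (auto simp: T_def abs_mult intro!: divide_right_mono)
    also have "\<dots> = M n"
      by (simp add: M_def power_divide distrib_right exp_add flip: exp_of_nat_mult)
    finally show ?thesis .
  qed
  have sumM: "summable M"
    unfolding M_def using lam lam0 by (intro summable_mult summable_geometric) auto
  have sumT: "summable (\<lambda>n. T n x)" if "x \<in> {0..1}" for x
    using bound[OF that] by (intro summable_comparison_test'[OF sumM])
  define \<Psi> where "\<Psi> = (\<lambda>x. \<Sum>n. T n x)"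
  have "uniform_limit {0..1} (\<lambda>n x. \<Sum>i<n. T i x) \<Psi> sequentially"
    unfolding \<Psi>_def using bound by (intro Weierstrass_m_test[OF _ sumM]) auto
  moreover have "continuous_on {0..1} (\<lambda>x. \<Sum>i<n. T i x)" for n
    unfolding T_def total_var_def using lam0
    by (intro continuous_intros continuous_on_lap_var) auto
  ultimately have contPsi: "continuous_on {0..1} \<Psi>"
    by (intro uniform_limit_theorem[where F = sequentially]) auto
  have diff: "(\<lambda>n. T n y - T n x) sums (\<Psi> y - \<Psi> x)" if "x \<in> {0..1}" "y \<in> {0..1}" for x y
    unfolding \<Psi>_def using sumT that by (intro sums_diff summable_sums) auto
  have Tmono: "0 \<le> T n y - T n x" if "x \<le> y" for n x y
    using mono[OF that] lam0 by (simp add: T_def divide_right_mono)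
  \<comment> \<open>One strictly growing term suffices, and leo supplies an iterate mapping
    \<open>[x,y]\<close> onto the unit interval.\<close>
  have strict: "\<Psi> x < \<Psi> y" if xy: "x \<in> {0..1}" "y \<in> {0..1}" "x < y" for x y
  proof -
    have "openin (top_of_set {0..1}) {x<..<y}" using xy by (intro openin_unit_interval) auto
    moreover have "{x<..<y} \<noteq> {}" using xy by simp
    ultimately obtain n where "(f ^^ n) ` {x<..<y} = {0..1}" using leo unfolding leo_def by blast
    moreover have "(f ^^ n) ` {x<..<y} \<subseteq> (f ^^ n) ` {x..y}" by (intro image_mono) auto
    moreover have "(f ^^ n) ` {x..y} \<subseteq> {0..1}" using funpow_in_interval[OF interval_map] xy by (intro image_subsetI) auto
    ultimately have "(f ^^ n) ` {x..y} = {0..1}" by blast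
    then have "0 < T n y - T n x"
      using total_var_strict[OF fin xy] lam0 by (simp add: T_def divide_strict_right_mono)
    moreover have "0 \<le> T n y - T n x" for n using Tmono xy by simp
    ultimately have "0 < (\<Sum>n. T n y - T n x)"
      using diff[OF xy(1,2)] by (intro suminf_pos2) (auto simp: sums_iff)
    then show ?thesis using diff[OF xy(1,2)] by (simp add: sums_iff)
  qed
  have step: "\<bar>\<Psi> (f x) - \<Psi> (f y)\<bar> \<le> L * (\<Psi> y - \<Psi> x)" if xy: "x \<in> {0..1}" "y \<in> {0..1}" "x \<le> y" for x y
  proof -
    have fxy: "f x \<in> {0..1}" "f y \<in> {0..1}" using xy interval_map by (auto simp: interval_map_def image_subset_iff)
    have le: "norm (T n (f x) - T n (f y)) \<le> L * (T (Suc n) y - T (Suc n) x)" for n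
    proof -
      have "norm (T n (f x) - T n (f y)) = \<bar>total_var n (f x) - total_var n (f y)\<bar> / L ^ n"
        using lam0 by (simp add: T_def flip: diff_divide_distrib)
      also have "\<dots> \<le> (total_var (Suc n) y - total_var (Suc n) x) / L ^ n"
        using lam0 xy by (intro divide_right_mono total_var_step fin) auto
      also have "\<dots> = L * (T (Suc n) y - T (Suc n) x)"
        using lam0 by (simp add: T_def flip: diff_divide_distrib)
      finally show ?thesis .
    qed
    \<comment> \<open>Shifting the index produces the factor \<open>L\<close>. The shifted series
      lacks the increment of term \<open>0\<close>, which is nonnegative and can be added back in
      the estimate.\<close>
    have s: "(\<lambda>n. T (Suc n) y - T (Suc n) x) sums (\<Psi> y - \<Psi> x - (T 0 y - T 0 x))"
      using diff[OF xy(1,2)] by (simp add: sums_Suc_iff[of "\<lambda>n. T n y - T n x"])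
    have "norm (\<Sum>n. T n (f x) - T n (f y)) \<le> (\<Sum>n. L * (T (Suc n) y - T (Suc n) x))"
      using le s by (intro norm_suminf_le summable_mult) (auto simp: sums_iff)
    also have "\<dots> = L * (\<Psi> y - \<Psi> x - (T 0 y - T 0 x))"
      using s by (subst suminf_mult) (auto simp: sums_iff)
    also have "\<dots> \<le> L * (\<Psi> y - \<Psi> x)"
      using Tmono[OF xy(3), of 0] lam0 by (intro mult_left_mono) auto
    finally show ?thesis using diff[OF fxy(2,1)] by (simp add: sums_iff)
  qed
  have Psi0: "\<Psi> 0 = 0" by (simp add: \<Psi>_def T_def zero)
  have Psi1: "0 < \<Psi> 1" using strict[of 0 1] Psi0 by simp
  define \<psi> where "\<psi> = (\<lambda>x. \<Psi> x / \<Psi> 1)"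
  have cont: "continuous_on {0..1} \<psi>" unfolding \<psi>_def using Psi1 contPsi by (intro continuous_intros) auto
  have psi_less: "\<psi> x < \<psi> y" if "x \<in> {0..1}" "y \<in> {0..1}" "x < y" for x y
    using strict[OF that] Psi1 by (simp add: \<psi>_def divide_strict_right_mono)
  have psi01: "\<psi> 0 = 0" "\<psi> 1 = 1" using Psi0 Psi1 by (auto simp: \<psi>_def)
  have inj: "inj_on \<psi> {0..1}"
    by (intro linorder_inj_onI) (use psi_less in force)+
  have "\<psi> ` {0..1} = {0..1}"
  proof
    show "\<psi> ` {0..1} \<subseteq> {0..1}"
    proof (rule image_subsetI)
      fix x :: real assume "x \<in> {0..1}"
      then show "\<psi> x \<in> {0..1}"
        using psi_less[of 0 x] psi_less[of x 1] psi01 by (cases "x = 0"; cases "x = 1") auto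
    qed
    show "{0..1} \<subseteq> \<psi> ` {0..1}"
    proof
      fix t :: real assume "t \<in> {0..1}"
      then show "t \<in> \<psi> ` {0..1}" using IVT'[of \<psi> 0 t 1] psi01 cont by auto
    qed
  qed
  then obtain \<psi>' where hom: "homeomorphism {0..1} {0..1} \<psi> \<psi>'"
    using homeomorphism_compact[OF compact_Icc cont _ inj] by blast
  have le: "\<bar>\<psi> (f x) - \<psi> (f y)\<bar> \<le> L * \<bar>\<psi> x - \<psi> y\<bar>" if "x \<in> {0..1}" "y \<in> {0..1}" "x \<le> y" for x y
  proof -
    have "\<bar>\<psi> (f x) - \<psi> (f y)\<bar> = \<bar>\<Psi> (f x) - \<Psi> (f y)\<bar> / \<Psi> 1"
      using Psi1 by (simp add: \<psi>_def flip: diff_divide_distrib)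
    also have "\<dots> \<le> L * (\<Psi> y - \<Psi> x) / \<Psi> 1" using step[OF that] Psi1 by (intro divide_right_mono) auto
    also have "\<dots> = L * (\<psi> y - \<psi> x)" by (simp add: \<psi>_def flip: diff_divide_distrib)
    also have "\<dots> \<le> L * \<bar>\<psi> x - \<psi> y\<bar>" using lam0 by (intro mult_left_mono) auto
    finally show ?thesis .
  qed
  have "lipschitz_on L {0..1} (\<psi> \<circ> f \<circ> \<psi>')"
  proof (rule lipschitz_onI)
    fix u v :: real assume uv: "u \<in> {0..1}" "v \<in> {0..1}"
    then have "\<psi>' u \<in> {0..1}" "\<psi>' v \<in> {0..1}" "\<psi> (\<psi>' u) = u" "\<psi> (\<psi>' v) = v"
      using hom by (auto simp: homeomorphism_def)
    then show "dist ((\<psi> \<circ> f \<circ> \<psi>') u) ((\<psi> \<circ> f \<circ> \<psi>') v) \<le> L * dist u v"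
      using le[of "\<psi>' u" "\<psi>' v"] le[of "\<psi>' v" "\<psi>' u"]
      by (cases "\<psi>' u \<le> \<psi>' v") (auto simp: dist_real_def abs_minus_commute)
  qed (use lam0 in simp)
  with hom show ?thesis by blast
qed

text \<open>A countable \<open>P\<close> misses some \<open>z\<close> in the interval; the nearest
  points of the closed set \<open>P\<close> on both sides of \<open>z\<close> bound a gap.\<close>

lemma ex_partition_gap:
  assumes "interval_map f" and P: "partition_set f P"
  obtains p q where "partition_gap f P p q"
proof -
  have "uncountable {0..1::real}" by (simp add: uncountable_closed_interval)
  then obtain z where z: "z \<in> {0..1}" "z \<notin> P"
    using P unfolding partition_set_def by (metis countable_subset subsetI)
  have "bounded P" using P by (auto simp: partition_set_def intro: bounded_subset[OF bounded_closed_interval])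
  then have "compact (P \<inter> {..z})" "compact (P \<inter> {z..})"
    using P unfolding compact_eq_bounded_closed partition_set_def by (auto intro: bounded_subset)
  moreover have "0 \<in> P \<inter> {..z}" "1 \<in> P \<inter> {z..}" using P z by (auto simp: partition_set_def)
  ultimately obtain p q where p: "p \<in> P \<inter> {..z}" "\<And>x. x \<in> P \<inter> {..z} \<Longrightarrow> x \<le> p"
    and q: "q \<in> P \<inter> {z..}" "\<And>x. x \<in> P \<inter> {z..} \<Longrightarrow> q \<le> x"
    by (metis compact_attains_inf compact_attains_sup empty_iff)
  have "p < z" "z < q" using p(1) q(1) z by (auto simp: less_le)
  moreover have "x \<notin> P" if "p < x" "x < q" for x
    using p(2)[of x] q(2)[of x] that by (cases "x \<le> z") auto
  ultimately show ?thesis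
    using assms p(1) q(1) by (intro that[of p q] partition_gap.intro) auto
qed

section \<open>Surjectivity and the lower bound for Lipschitz constants\<close>

lemma leo_surj:
  assumes "interval_map f" "leo f"
  shows "f ` {0..1} = {0..1}"
proof -
  have "openin (top_of_set {0..1}) {0<..<1::real}" by (rule openin_unit_interval) auto
  moreover have "{0<..<1::real} \<noteq> {}" by simp
  ultimately obtain n where n: "(f ^^ n) ` {0<..<1} = {0..1}"
    using assms(2) unfolding leo_def by blast
  show ?thesis
  proof (cases n)
    \<comment> \<open>Impossible: the open interval would be all of \<open>[0,1]\<close>.\<close>
    case 0
    then have "(0::real) \<in> {0<..<1}" using n by simp
    then show ?thesis by simp
  next
    case (Suc k)
    have "(f ^^ k) ` {0<..<1} \<subseteq> {0..1}"
      using funpow_in_interval[OF assms(1)] by (intro image_subsetI) auto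
    then have "(f ^^ n) ` {0<..<1} \<subseteq> f ` {0..1}" by (auto simp: Suc image_comp[symmetric])
    then show ?thesis using n assms(1) by (auto simp: interval_map_def)
  qed
qed

text \<open>The conjugate is onto, so it takes the values \<open>0\<close> and \<open>1\<close> at
  points at most \<open>1\<close> apart.\<close>

lemma lipschitz_conjugate_ge_1:
  fixes f \<psi> \<psi>' :: "real \<Rightarrow> real"
  assumes surj: "f ` {0..1} = {0..1}"
    and hom: "homeomorphism {0..1} {0..1} \<psi> \<psi>'"
    and lip: "lipschitz_on L {0..1} (\<psi> \<circ> f \<circ> \<psi>')"
  shows "1 \<le> L"
proof -
  have "(\<psi> \<circ> f \<circ> \<psi>') ` {0..1} = {0..1}"
    using hom surj by (simp only: homeomorphism_def flip: image_comp)
  then have "0 \<in> (\<psi> \<circ> f \<circ> \<psi>') ` {0..1}" "1 \<in> (\<psi> \<circ> f \<circ> \<psi>') ` {0..1}" by auto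
  then obtain u v where uv: "u \<in> {0..1}" "v \<in> {0..1}" "(\<psi> \<circ> f \<circ> \<psi>') u = 0" "(\<psi> \<circ> f \<circ> \<psi>') v = 1"
    by (metis (no_types, lifting) imageE)
  have "1 \<le> L * \<bar>u - v\<bar>" using lipschitz_onD[OF lip uv(1,2)] uv(3,4) by (simp add: dist_real_def)
  also have "\<dots> \<le> L * 1" using uv lipschitz_on_nonneg[OF lip] by (intro mult_left_mono) auto
  finally show ?thesis by simp
qed

theorem theorem4p15:
  fixes f :: "real \<Rightarrow> real" and P :: "real set"
  assumes "interval_map f"
    and "topologically_mixing f"
    and "countably_markov f"
    and "partition_set f P"
    and "leo f"
  shows "inf_lipschitz f = ereal_exp (topological_entropy {0..1} f)"
proof (rule antisym)
  show "ereal_exp (topological_entropy {0..1} f) \<le> inf_lipschitz f"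
    unfolding inf_lipschitz_def
  proof (rule Inf_greatest, clarify)
    fix L :: real and \<psi> \<psi>' :: "real \<Rightarrow> real"
    assume hom: "homeomorphism {0..1} {0..1} \<psi> \<psi>'" and lip: "lipschitz_on L {0..1} (\<psi> \<circ> f \<circ> \<psi>')"
    have L: "1 \<le> L" by (rule lipschitz_conjugate_ge_1[OF leo_surj[OF assms(1,5)] hom lip])
    have "topological_entropy {0..1} f \<le> ereal (ln L)"
      by (rule entropy_le_ln_lipschitz[OF assms(1) hom lip L])
    then show "ereal_exp (topological_entropy {0..1} f) \<le> ereal L"
      using L by (cases "topological_entropy {0..1} f") (auto simp: ereal_exp_def ln_ge_iff)
  qed
  show "inf_lipschitz f \<le> ereal_exp (topological_entropy {0..1} f)"
  \<comment> \<open>Only finite entropy needs work: infinite entropy makes the right side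
    infinite.\<close>
  proof (cases "topological_entropy {0..1} f")
    case (real h)
    obtain p q where "partition_gap f P p q" by (rule ex_partition_gap[OF assms(1,4)])
    then interpret partition_gap f P p q .
    have le: "inf_lipschitz f \<le> ereal L" if "exp h < L" for L
      unfolding inf_lipschitz_def using lipschitz_conjugate[OF assms(5) real that] by (intro Inf_lower) blast
    \<comment> \<open>The series needs \<open>exp h < L\<close> strictly, so \<open>exp h\<close> is
      reached only as \<open>e\<close> tends to \<open>0\<close>.\<close>
    have "inf_lipschitz f \<le> ereal (exp h)"
    proof (rule ereal_le_epsilon2)
      fix e :: real assume "0 < e"
      then show "inf_lipschitz f \<le> ereal (exp h) + ereal e" using le[of "exp h + e"] by simp
    qed
    then show ?thesis by (simp add: real ereal_exp_def)
  next
    case PInf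
    then show ?thesis by (simp add: ereal_exp_def)
  next
    case MInf
    with topological_entropy_nonneg[of "{0..1}" f] show ?thesis by simp
  qed
qed

end
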